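(* Let $1\le n\le m$ be integers and $\mathbb{K}=\mathbb{R}$ or $\mathbb{C}$. Let $\mathbb{GL}_{n,m}^>$ be the open set of matrices $A\in\mathbb{K}^{n\times m}$ of rank $n$ whose smallest singular value $\sigma_n(A)$ is simple, equipped with the condition metric $\langle M,N\rangle_{\kappa,A}=\sigma_n(A)^{-2}\,\mathrm{Re}\langle M,N\rangle_F$. Then $\sigma_n^{-2}$ is logarithmically convex on $\mathbb{GL}_{n,m}^>$, i.e. for any geodesic curve $\gamma(t)$ in $\mathbb{GL}_{n,m}^>$ for the condition metric, the map $t\mapsto \log\left(\sigma_n^{-2}(\gamma(t))\right)$ is convex.
   Context: The singular values of $A\in\mathbb{K}^{n\times m}$ are $\sigma_1(A)\ge\cdots\ge\sigma_{n-1}(A)\ge\sigma_n(A)\ge 0$. The Frobenius Hermitian product is $\langle M,N\rangle_F=\mathrm{trace}(N^*M)=\sum_{i,j}m_{ij}\overline{n_{ij}}$. $\mathbb{GL}_{n,m}$ is the set of $A\in\mathbb{K}^{n\times m}$ with rank $n$ (equivalently $\sigma_n(A)>0$), and $\mathbb{GL}_{n,m}^>=\{A\in\mathbb{GL}_{n,m}:\sigma_{n-1}(A)>\sigma_n(A)\}$, i.e. the matrices in $\mathbb{GL}_{n,m}$ whose smallest singular value has multiplicity one. It is an open subset of the real vector space $\mathbb{K}^{n\times m}$, and $\sigma_n$ is smooth on it, so the condition metric is a smooth Riemannian metric. Geodesics are geodesics of this Riemannian metric (not necessarily minimizing). *)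

theory Defs
  imports "HOL-Analysis.Analysis" "HOL-Library.Multiset" "Jordan_Normal_Form.Conjugate"
begin

(* Matrices with n rows and m columns over K are elements of 'k^'m^'n with CARD('n) = n and
   CARD('m) = m.  Only the instances 'k = real and 'k = complex are intended; there
   "conjugate" is the identity and cnj, respectively. *)

definition adjoint_mat :: "'k::conjugate^'m^'n \<Rightarrow> 'k^'n^'m" where
  "adjoint_mat A = transpose (map_matrix conjugate A)"

definition frob :: "'k::{real_normed_field,conjugate}^'m^'n \<Rightarrow> 'k^'m^'n \<Rightarrow> 'k" where
  "frob M N = trace (adjoint_mat N ** M)"

(* In both instances the real inner product with 1 is the real part. *)
definition re_part :: "'k::{real_normed_field,euclidean_space} \<Rightarrow> real" where
  "re_part x = x \<bullet> 1"

lemma re_part_real: "re_part (x::real) = x"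
  by (simp add: re_part_def)

lemma re_part_complex: "re_part (z::complex) = Re z"
  by (simp add: re_part_def inner_complex_def)

(* s \<ge> 0 is a singular value of A iff s^2 is an eigenvalue of the Hermitian n x n matrix A A*;
   its multiplicity is that of the eigenvalue.  All eigenvalues of A A* are real and
   nonnegative, so for n \<le> m this gives exactly the n singular values of A. *)
definition sv_mult :: "'k::{real_normed_field,conjugate}^'m^'n \<Rightarrow> real \<Rightarrow> nat" where
  "sv_mult A s =
     (if s \<ge> 0 then vec.dim {v. (A ** adjoint_mat A) *v v = of_real (s\<^sup>2) *s v} else 0)"

definition singular_values :: "'k::{real_normed_field,conjugate}^'m^'n \<Rightarrow> real list" where
  "singular_values A =
     rev (sorted_list_of_multiset (\<Sum>s | sv_mult A s > 0. replicate_mset (sv_mult A s) s))"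

(* Decreasing order, indexed from 1. *)
definition sigma :: "nat \<Rightarrow> 'k::{real_normed_field,conjugate}^'m^'n \<Rightarrow> real" where
  "sigma k A = singular_values A ! (k - 1)"

definition sigma_min :: "'k::{real_normed_field,conjugate}^'m^'n \<Rightarrow> real" where
  "sigma_min A = sigma CARD('n) A"

definition GL :: "('k::{real_normed_field,conjugate}^'m^'n) set" where
  "GL = {A. rank A = CARD('n)}"

(* Multiplicity one amounts to sigma (n-1) A > sigma n A when n \<ge> 2; when n = 1 the smallest
   singular value is always simple. *)
definition GL_gt :: "('k::{real_normed_field,conjugate}^'m^'n) set" where
  "GL_gt = {A \<in> GL. sv_mult A (sigma_min A) = 1}"

definition condition_metric ::
  "'k::{real_normed_field,euclidean_space,conjugate}^'m^'n \<Rightarrow> 'k^'m^'n \<Rightarrow> 'k^'m^'n \<Rightarrow> real" where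
  "condition_metric A M N = inverse ((sigma_min A)\<^sup>2) * re_part (frob M N)"

(* Riemannian metrics on an open subset of a Euclidean space, in its global chart:
   g p u v is the inner product at the point p of the tangent vectors u and v. *)

definition metric_deriv ::
  "('e::euclidean_space \<Rightarrow> 'e \<Rightarrow> 'e \<Rightarrow> real) \<Rightarrow> 'e \<Rightarrow> 'e \<Rightarrow> 'e \<Rightarrow> 'e \<Rightarrow> real" where
  "metric_deriv g p u v w = frechet_derivative (\<lambda>q. g q v w) (at p) u"

(* The Koszul formula for constant vector fields u, v, w, i.e. the Christoffel symbols of the
   first kind. *)
definition christoffel1 ::
  "('e::euclidean_space \<Rightarrow> 'e \<Rightarrow> 'e \<Rightarrow> real) \<Rightarrow> 'e \<Rightarrow> 'e \<Rightarrow> 'e \<Rightarrow> 'e \<Rightarrow> real" where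
  "christoffel1 g p u v w =
     (metric_deriv g p u v w + metric_deriv g p v u w - metric_deriv g p w u v) / 2"

(* The Christoffel map of the Levi-Civita connection: the covariant derivative of the constant
   field v in the direction u.  See christoffel_unique and christoffel_exists for
   well-definedness. *)
definition christoffel ::
  "('e::euclidean_space \<Rightarrow> 'e \<Rightarrow> 'e \<Rightarrow> real) \<Rightarrow> 'e \<Rightarrow> 'e \<Rightarrow> 'e \<Rightarrow> 'e" where
  "christoffel g p u v = (THE z. \<forall>w. g p z w = christoffel1 g p u v w)"

lemma christoffel_unique:
  assumes "\<And>w. linear (\<lambda>z. g p z w)" and "\<And>z. z \<noteq> 0 \<Longrightarrow> g p z z > 0"
    and z: "\<And>w. g p z w = christoffel1 g p u v w"
  shows "christoffel g p u v = z"
  unfolding christoffel_def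
proof (rule the_equality)
  show "\<forall>w. g p z w = christoffel1 g p u v w" using z by blast
next
  fix y assume y: "\<forall>w. g p y w = christoffel1 g p u v w"
  have "g p (y - z) (y - z) = g p y (y - z) - g p z (y - z)"
    using linear_diff[OF assms(1)] .
  also have "\<dots> = 0" using y z by simp
  finally show "y = z" using assms(2)[of "y - z"] by force
qed

lemma christoffel_exists:
  assumes lin1: "\<And>w. linear (\<lambda>z. g p z w)" and lin2: "\<And>z. linear (\<lambda>w. g p z w)"
    and pos: "\<And>z. z \<noteq> 0 \<Longrightarrow> g p z z > 0"
    and lin: "linear (\<lambda>w. christoffel1 g p u v w)"
  shows "g p (christoffel g p u v) w = christoffel1 g p u v w"
proof -
  define L where "L = (\<lambda>z. \<Sum>b\<in>Basis. g p z b *\<^sub>R b)"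
  have Lb: "L z \<bullet> b = g p z b" if "b \<in> Basis" for z b
    using that by (simp add: L_def inner_sum_left inner_Basis if_distrib cong: if_cong)
  have L: "linear L"
    unfolding L_def
    by (intro linear_compose_sum ballI linearI)
      (simp_all add: linear_add[OF lin1] linear_cmul[OF lin1] scaleR_left_distrib)
  have eq: "f = h" if "linear f" "linear h" "\<And>b. b \<in> Basis \<Longrightarrow> f b = h b"
    for f h :: "'a \<Rightarrow> real"
    using linear_eq_stdbasis that by blast
  have "inj L"
  proof (rule linear_injective_0[OF L, THEN iffD2], intro allI impI)
    fix z assume "L z = 0"
    then have "g p z b = 0" if "b \<in> Basis" for b
      using Lb[OF that, of z] by simp
    then have "(\<lambda>w. g p z w) = (\<lambda>w. 0)"
      by (intro eq lin2) (auto simp: linear_zero)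
    then have "g p z z = 0" by meson
    then show "z = 0" using pos[of z] by force
  qed
  then have "surj L" using linear_injective_imp_surjective[OF L] by blast
  then obtain z where "L z = (\<Sum>b\<in>Basis. christoffel1 g p u v b *\<^sub>R b)" by (metis surjD)
  then have "g p z b = christoffel1 g p u v b" if "b \<in> Basis" for b
    using Lb[OF that, of z] that
    by (simp add: inner_sum_left inner_Basis if_distrib cong: if_cong)
  then have "(\<lambda>w. g p z w) = (\<lambda>w. christoffel1 g p u v w)"
    by (intro eq lin2 lin)
  then have z: "g p z w = christoffel1 g p u v w" for w by meson
  show ?thesis
    using christoffel_unique[OF lin1 pos z] z by simp
qed

(* The geodesic equation: the covariant derivative of the velocity along the curve is zero.
   J is an arbitrary interval; derivatives at end points belonging to J are one-sided. *)
definition geodesic_on ::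
  "'e set \<Rightarrow> ('e::euclidean_space \<Rightarrow> 'e \<Rightarrow> 'e \<Rightarrow> real) \<Rightarrow> real set \<Rightarrow> (real \<Rightarrow> 'e) \<Rightarrow> bool" where
  "geodesic_on U g J \<gamma> \<longleftrightarrow>
     is_interval J \<and> \<gamma> ` J \<subseteq> U \<and>
     (\<exists>\<gamma>' \<gamma>''. \<forall>t\<in>J.
        (\<gamma> has_vector_derivative \<gamma>' t) (at t within J) \<and>
        (\<gamma>' has_vector_derivative \<gamma>'' t) (at t within J) \<and>
        \<gamma>'' t + christoffel g (\<gamma> t) (\<gamma>' t) (\<gamma>' t) = 0)"

definition log_convex ::
  "'e set \<Rightarrow> ('e::euclidean_space \<Rightarrow> 'e \<Rightarrow> 'e \<Rightarrow> real) \<Rightarrow> ('e \<Rightarrow> real) \<Rightarrow> bool" where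
  "log_convex U g f \<longleftrightarrow>
     (\<forall>J \<gamma>. geodesic_on U g J \<gamma> \<longrightarrow> convex_on J (\<lambda>t. ln (f (\<gamma> t))))"

end

theory Submission
  imports Defs
begin

text \<open>
  Write \<open>h(A)\<close> for the square of the smallest singular value, that is, for the minimum of
  \<open>|A\<^sup>* x|\<^sup>2\<close> over unit vectors \<open>x\<close>. The function \<open>h(A) - |A|\<^sup>2\<close> is concave, being a minimum of the
  negative semidefinite quadratic forms \<open>|A\<^sup>* x|\<^sup>2 - |A|\<^sup>2\<close>, and \<open>h\<close> satisfies the eikonal equation
  \<open>|\<nabla>h|\<^sup>2 = 4 h\<close>, because its gradient at \<open>A\<close> is \<open>2 x x\<^sup>* A\<close> for the minimizing \<open>x\<close>. These
  two facts give the theorem: along a geodesic of the conformal metric \<open>h\<^sup>-\<^sup>1 \<langle>\<cdot>, \<cdot>\<rangle>\<close> with velocity \<open>v\<close>,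
  the second derivative of \<open>- ln h\<close> is, after the terms with \<open>\<nabla>h\<close> have cancelled by the eikonal
  equation, the quotient \<open>(2 |v|\<^sup>2 - D\<^sup>2h(v,v)) / h\<close>, and concavity makes it nonnegative.

  The proof below avoids second derivatives of \<open>h\<close>. Near a time \<open>t\<close>, the function \<open>- ln h\<close> along the
  geodesic is supported from below by \<open>- ln |\<gamma>\<^sup>* x|\<^sup>2\<close>, where \<open>x\<close> is the minimizing vector at time \<open>t\<close>,
  kept fixed. This support function is twice differentiable at \<open>t\<close>, and the same computation shows that
  its second derivative there is nonnegative; a continuous function with such support functions is convex
  (\<open>convex_on_if_supported_from_below\<close>). Only the first derivative of \<open>h\<close> is needed, to determine the
  Christoffel symbols (\<open>christoffel_condition_metric\<close>). It exists where the smallest singular value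
  is simple (\<open>sigma_min_sq_has_derivative\<close>), by a direct second order estimate of the perturbation.

  The link between the list of singular values, defined by multiplicities, and the variational
  description is the spectral theorem for \<open>A A\<^sup>*\<close> (\<open>gram_eigenbasis\<close>), which leads to
  \<open>sigma_min_eigenvector\<close> and \<open>sigma_min_le\<close>.
\<close>

section \<open>Real and complex vectors with their real inner product\<close>

text \<open>The argument is the same over \<open>\<real>\<close> and \<open>\<complex>\<close>. All it asks of the conjugation is that it is the adjoint of
multiplication for the real inner product of the scalars, so everything is done in real Euclidean
geometry, and Hermitian orthogonality becomes real orthogonality to all scalar multiples.\<close>
class real_complex_field = real_normed_field + euclidean_space + conjugatable_field +
  assumes inner_mult_conjugate: "inner (a * x) y = inner x (conjugate a * y)"

instance real :: real_complex_field
  by standard (simp add: algebra_simps)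

instance complex :: real_complex_field
  by standard (simp add: inner_complex_def algebra_simps)

lemma re_part_mult_conjugate: "re_part (x * conjugate y) = x \<bullet> (y :: 'k::real_complex_field)"
  using inner_mult_conjugate[of "conjugate y" x 1] by (simp add: re_part_def mult.commute)

lemma norm_conjugate [simp]: "norm (conjugate x) = norm (x :: 'k::real_complex_field)"
proof -
  have "conjugate x \<bullet> conjugate x = x \<bullet> x"
    using inner_mult_conjugate[of "conjugate x" 1 "conjugate x"] inner_mult_conjugate[of x 1 x]
    by (simp add: mult.commute)
  then show ?thesis by (simp add: norm_eq_sqrt_inner)
qed

lemma norm_vec_scale:
  fixes x :: "'k::real_complex_field^'n"
  shows "norm (c *s x) = norm c * norm x"
  by (simp add: norm_vec_def norm_mult L2_set_right_distrib)

lemma scaleR_eq_vec_scale: "r *\<^sub>R x = of_real r *s (x :: 'k::real_complex_field^'n)"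
  by (simp add: vec_eq_iff scaleR_conv_of_real[where 'a = 'k])

lemma span_vec_span: "span (vec.span B) = vec.span (B :: ('k::real_complex_field^'n) set)"
proof -
  have "subspace (vec.span B)"
    by (auto simp: subspace_def scaleR_eq_vec_scale vec.span_zero vec.span_add vec.span_scale)
  then show ?thesis by (simp add: span_eq_iff)
qed

lemma adjoint_mat_nth: "adjoint_mat A $ j $ i = conjugate (A $ i $ j)"
  by (simp add: adjoint_mat_def transpose_def map_matrix_def)

lemma inner_adjoint:
  fixes A :: "'k::real_complex_field^'m^'n"
  shows "(A *v y) \<bullet> x = y \<bullet> (adjoint_mat A *v x)"
proof -
  have "(A *v y) \<bullet> x = (\<Sum>i\<in>UNIV. \<Sum>j\<in>UNIV. (A$i$j * y$j) \<bullet> x$i)"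
    by (simp add: inner_vec_def matrix_vector_mult_def inner_sum_left)
  also have "\<dots> = (\<Sum>j\<in>UNIV. \<Sum>i\<in>UNIV. y$j \<bullet> (conjugate (A$i$j) * x$i))"
    by (subst sum.swap) (simp add: inner_mult_conjugate)
  finally show ?thesis
    by (simp add: inner_vec_def matrix_vector_mult_def inner_sum_right adjoint_mat_nth)
qed

lemma re_part_frob:
  fixes M N :: "'k::real_complex_field^'m^'n"
  shows "re_part (frob M N) = M \<bullet> N"
proof -
  have "re_part (frob M N) = (\<Sum>j\<in>UNIV. \<Sum>i\<in>UNIV. re_part (M$i$j * conjugate (N$i$j)))"
    by (simp add: frob_def trace_def matrix_matrix_mult_def adjoint_mat_nth re_part_def
        inner_sum_left mult.commute)
  also have "\<dots> = M \<bullet> N"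
    by (subst sum.swap) (simp add: re_part_mult_conjugate inner_vec_def)
  finally show ?thesis .
qed

text \<open>The rank-one matrix \<open>x w\<^sup>*\<close>. It represents the linear form \<open>E \<mapsto> (E\<^sup>* x) \<bullet> w\<close>; in particular
\<open>2 x w\<^sup>*\<close> with \<open>w = A\<^sup>* x\<close> is the gradient of \<open>A \<mapsto> |A\<^sup>* x|\<^sup>2\<close>.\<close>
definition outer :: "'k::real_complex_field^'n \<Rightarrow> 'k^'m \<Rightarrow> 'k^'m^'n" where
  "outer x w = (\<chi> i j. x $ i * conjugate (w $ j))"

lemma inner_outer: "outer x w \<bullet> E = (adjoint_mat E *v x) \<bullet> w"
proof -
  have e: "(a * conjugate b) \<bullet> e = (conjugate e * a) \<bullet> b" for a b e :: 'a
    using inner_mult_conjugate[of "conjugate b" a e] inner_mult_conjugate[of "conjugate e" a b]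
    by (simp add: mult.commute)
  have "outer x w \<bullet> E = (\<Sum>j\<in>UNIV. \<Sum>i\<in>UNIV. (conjugate (E$i$j) * x$i) \<bullet> w$j)"
    by (subst sum.swap) (simp add: inner_vec_def outer_def e)
  then show ?thesis
    by (simp add: inner_vec_def matrix_vector_mult_def inner_sum_left adjoint_mat_nth)
qed

lemma norm_outer: "norm (outer x w) = norm x * norm w"
proof -
  have "outer x w $ i = x $ i *s (\<chi> j. conjugate (w $ j))" for i
    by (simp add: outer_def vec_eq_iff)
  then have "norm (outer x w $ i) = norm (x $ i) * norm w" for i
    by (simp only: norm_vec_scale) (simp add: norm_vec_def)
  then show ?thesis
    by (simp add: norm_vec_def[of "outer x w"] L2_set_left_distrib norm_vec_def[of x])
qed

text \<open>The Frobenius norm dominates the operator norm. With \<open>w = A\<^sup>* x\<close>, this is the Cauchy-Schwarz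
inequality for the pair \<open>x w\<^sup>*\<close>, \<open>A\<close>. It is the only inequality behind the convexity: it says that
the quadratic form \<open>A \<mapsto> |A\<^sup>* x|\<^sup>2 - |A|\<^sup>2\<close> is negative semidefinite for a unit vector \<open>x\<close>.\<close>
lemma norm_adjoint_mult_le:
  fixes A :: "'k::real_complex_field^'m^'n"
  shows "norm (adjoint_mat A *v x) \<le> norm A * norm x"
proof -
  let ?w = "adjoint_mat A *v x"
  have "norm ?w * norm ?w = outer x ?w \<bullet> A"
    by (simp add: inner_outer flip: power2_eq_square power2_norm_eq_inner)
  also have "\<dots> \<le> (norm A * norm x) * norm ?w"
    using norm_cauchy_schwarz[of "outer x ?w" A] by (simp add: norm_outer mult_ac)
  finally show ?thesis
    by (cases "?w = 0") auto
qed

lemma linear_adjoint_mult: "linear (\<lambda>A :: 'k::real_complex_field^'m^'n. adjoint_mat A *v x)"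
proof (rule linearI)
  have *: "(adjoint_mat A *v x) \<bullet> w = A \<bullet> outer x w" for A :: "'k^'m^'n" and w
    by (metis inner_outer inner_commute)
  show "adjoint_mat (A + B) *v x = adjoint_mat A *v x + adjoint_mat B *v x" for A B :: "'k^'m^'n"
    by (rule vector_eq_rdot[THEN iffD1]) (simp add: * inner_add_left)
  show "adjoint_mat (r *\<^sub>R A) *v x = r *\<^sub>R (adjoint_mat A *v x)" for r and A :: "'k^'m^'n"
    by (rule vector_eq_rdot[THEN iffD1]) (simp add: *)
qed

section \<open>The smallest singular value as a minimum\<close>

text \<open>A minimizer \<open>x\<close> of the quadratic form of \<open>T\<close> on the unit sphere of an invariant subspace is an
eigenvector: the residual \<open>z = T x - l x\<close> lies in the subspace again, and moving from \<open>x\<close> in the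
direction \<open>- z\<close> would decrease \<open>T y \<bullet> y - l |y|\<^sup>2\<close> to first order if \<open>z\<close> were not zero.\<close>
lemma rayleigh_minimizer:
  fixes T :: "'a::euclidean_space \<Rightarrow> 'a"
  assumes T: "linear T" and sym: "\<And>x y. T x \<bullet> y = x \<bullet> T y"
    and S: "subspace S" and inv: "\<And>x. x \<in> S \<Longrightarrow> T x \<in> S" and ne: "S \<noteq> {0}"
  obtains x l where "x \<in> S" "norm x = 1" "T x = l *\<^sub>R x"
    "\<And>y. y \<in> S \<Longrightarrow> l * (norm y)\<^sup>2 \<le> T y \<bullet> y"
proof -
  let ?K = "S \<inter> sphere 0 1"
  obtain v where v: "v \<in> S" "v \<noteq> 0" using ne S subspace_0 by blast
  then have "v /\<^sub>R norm v \<in> ?K" using S by (simp add: subspace_scale)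
  moreover have "compact ?K"
    by (simp add: S closed_Int_compact closed_subspace)
  moreover have "continuous_on ?K (\<lambda>x. T x \<bullet> x)"
    by (intro continuous_intros linear_continuous_on linear_conv_bounded_linear[THEN iffD1] T)
  ultimately obtain x where x: "x \<in> ?K" and min: "\<And>y. y \<in> ?K \<Longrightarrow> T x \<bullet> x \<le> T y \<bullet> y"
    using continuous_attains_inf[of ?K "\<lambda>x. T x \<bullet> x"] by blast
  define l where "l = T x \<bullet> x"
  have quad: "l * (norm y)\<^sup>2 \<le> T y \<bullet> y" if y: "y \<in> S" for y
  proof (cases "y = 0")
    case False
    then have "y /\<^sub>R norm y \<in> ?K" using S y by (simp add: subspace_scale)
    from min[OF this] have "l \<le> (T y \<bullet> y) / (norm y)\<^sup>2"
      by (simp add: l_def linear_cmul[OF T] power2_eq_square divide_simps)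
    then show ?thesis using False by (simp add: pos_le_divide_eq)
  qed (simp add: linear_0[OF T])
  define z where "z = T x - l *\<^sub>R x"
  have z: "z \<in> S" using x S inv by (auto simp: z_def intro!: subspace_diff subspace_scale)
  have xx: "x \<bullet> x = 1" using x by (simp add: norm_eq_1)
  define c where "c = T z \<bullet> z - l * (z \<bullet> z)"
  have c: "c \<ge> 0" using quad[OF z] by (simp add: c_def power2_norm_eq_inner)
  have Txz: "T x \<bullet> z = z \<bullet> z + l * (x \<bullet> z)" by (simp add: z_def algebra_simps)
  have ineq: "0 \<le> 2 * t * (z \<bullet> z) + t\<^sup>2 * c" for t
  proof -
    have "x + t *\<^sub>R z \<in> S" using x z S by (auto intro!: subspace_add subspace_scale)
    from quad[OF this] have "l * ((x + t *\<^sub>R z) \<bullet> (x + t *\<^sub>R z))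
        \<le> T (x + t *\<^sub>R z) \<bullet> (x + t *\<^sub>R z)"
      by (simp only: power2_norm_eq_inner)
    moreover have "T (x + t *\<^sub>R z) \<bullet> (x + t *\<^sub>R z)
        = l + 2 * t * (z \<bullet> z + l * (x \<bullet> z)) + t\<^sup>2 * (T z \<bullet> z)"
      using sym[of z x] Txz l_def
      by (simp add: linear_add[OF T] linear_cmul[OF T] inner_add_left inner_add_right
          inner_commute power2_eq_square algebra_simps)
    moreover have "(x + t *\<^sub>R z) \<bullet> (x + t *\<^sub>R z) = 1 + 2 * t * (x \<bullet> z) + t\<^sup>2 * (z \<bullet> z)"
      using xx by (simp add: inner_add_left inner_add_right inner_commute power2_eq_square algebra_simps)
    ultimately have "l * (1 + 2 * t * (x \<bullet> z) + t\<^sup>2 * (z \<bullet> z))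
        \<le> l + 2 * t * (z \<bullet> z + l * (x \<bullet> z)) + t\<^sup>2 * (T z \<bullet> z)"
      by metis
    then show ?thesis by (simp add: c_def algebra_simps)
  qed
  have "z \<bullet> z = 0"
  proof (rule ccontr)
    assume nz: "z \<bullet> z \<noteq> 0"
    define q where "q = z \<bullet> z"
    have q: "q > 0" using nz by (simp add: q_def)
    \<comment> \<open>a step against the gradient that is short compared with the curvature \<open>c\<close>; the summand 1 covers \<open>c = 0\<close>\<close>
    have "0 \<le> 2 * (- q / (c+1)) * q + (- q / (c+1))\<^sup>2 * c"
      unfolding q_def by (rule ineq)
    also have "\<dots> = - (q\<^sup>2 * (c + 2)) / (c+1)\<^sup>2"
      using c by (simp add: divide_simps power2_eq_square) algebra
    also have "\<dots> < 0" using q c by (auto simp: divide_simps)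
    finally show False by simp
  qed
  then have "T x = l *\<^sub>R x" by (simp add: z_def)
  then show thesis using that[of x l] x quad by auto
qed

definition gram :: "'k::real_complex_field^'m^'n \<Rightarrow> 'k^'n^'n" where
  "gram A = A ** adjoint_mat A"

lemma inner_gram:
  "(gram A *v x) \<bullet> y = (adjoint_mat A *v x) \<bullet> (adjoint_mat A *v y)"
  by (simp add: gram_def inner_adjoint flip: matrix_vector_mul_assoc)

lemma gram_symmetric: "(gram A *v x) \<bullet> y = x \<bullet> (gram A *v y)"
  by (metis inner_gram inner_commute)

lemma linear_matrix_vector_mult:
  fixes A :: "'k::real_complex_field^'m^'n"
  shows "linear ((*v) A)"
  by (rule linearI)
    (simp_all add: matrix_vector_right_distrib scaleR_eq_vec_scale vector_scalar_commute)

lemma gram_eigenvalue: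
  assumes "gram A *v x = l *\<^sub>R x" and "norm x = 1"
  shows "l = (norm (adjoint_mat A *v x))\<^sup>2"
  using inner_gram[of A x x] assms by (simp add: power2_norm_eq_inner norm_eq_1)

text \<open>The Hermitian orthogonal complement, expressed by the real inner product.\<close>
definition kperp :: "('k::real_complex_field^'n) set \<Rightarrow> ('k^'n) set" where
  "kperp B = {y. \<forall>b\<in>B. \<forall>c. y \<bullet> (c *s b) = 0}"

lemma subspace_kperp: "subspace (kperp B)"
  by (simp add: subspace_def kperp_def inner_add_left)

lemma inner_kperp_span:
  assumes y: "y \<in> kperp B" and z: "z \<in> vec.span B"
  shows "y \<bullet> z = 0"
proof -
  let ?V = "{z. \<forall>c. y \<bullet> (c *s z) = 0}"
  have "vec.subspace ?V"
    by (rule vec.subspaceI)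
      (simp_all add: vector_add_ldistrib inner_add_right vector_smult_assoc)
  moreover have "B \<subseteq> ?V" using y by (auto simp: kperp_def)
  ultimately have "z \<in> ?V" using z vec.span_minimal by blast
  then have "y \<bullet> (1 *s z) = 0" by blast
  then show ?thesis by simp
qed

text \<open>The span over the scalar field is also a real subspace, so a real orthogonal vector exists.\<close>
lemma kperp_nontrivial:
  assumes "vec.span B \<noteq> UNIV"
  shows "kperp B \<noteq> {0}"
proof -
  obtain a where "a \<noteq> 0" and a: "\<And>x. x \<in> vec.span B \<Longrightarrow> a \<bullet> x = 0"
    using span_not_UNIV_orthogonal[of "vec.span B"] assms unfolding span_vec_span by blast
  have "a \<in> kperp B" by (simp add: kperp_def a vec.span_scale vec.span_base)
  then show ?thesis using \<open>a \<noteq> 0\<close> by blast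
qed

lemma eigenvector_in_kperp:
  assumes B: "\<forall>b\<in>B. \<exists>m. gram A *v b = m *\<^sub>R b" and ne: "kperp B \<noteq> {0}"
  obtains x l where "x \<in> kperp B" "norm x = 1" "gram A *v x = l *\<^sub>R x"
    "\<forall>y\<in>kperp B. l * (norm y)\<^sup>2 \<le> (norm (adjoint_mat A *v y))\<^sup>2"
proof -
  have inv: "gram A *v y \<in> kperp B" if y: "y \<in> kperp B" for y
    unfolding kperp_def
  proof (intro CollectI ballI allI)
    fix b c assume b: "b \<in> B"
    obtain m where "gram A *v b = m *\<^sub>R b" using B b by blast
    then have "gram A *v (c *s b) = (c * of_real m) *s b"
      by (simp add: vector_scalar_commute scaleR_eq_vec_scale vector_smult_assoc)
    then show "(gram A *v y) \<bullet> (c *s b) = 0"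
      using y b by (simp add: gram_symmetric kperp_def)
  qed
  show thesis
  proof (rule rayleigh_minimizer[OF linear_matrix_vector_mult[of "gram A"] _ subspace_kperp inv ne])
    show "(gram A *v x) \<bullet> y = x \<bullet> (gram A *v y)" for x y by (rule gram_symmetric)
  qed (use that in \<open>auto simp: inner_gram power2_norm_eq_inner\<close>)
qed

text \<open>The spectral theorem for \<open>A A\<^sup>*\<close>: as long as the eigenvectors found so far do not span, their
orthogonal complement is invariant and contributes a further one. What is needed about the basis is
its independence, because it serves to count multiplicities.\<close>
lemma gram_eigenbasis:
  fixes A :: "'k::real_complex_field^'m^'n"
  obtains B \<mu> where "finite B" "card B = CARD('n)" "vec.independent B"
    "\<And>b. b \<in> B \<Longrightarrow> norm b = 1" "\<And>b. b \<in> B \<Longrightarrow> gram A *v b = \<mu> b *\<^sub>R b"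
proof -
  have "\<exists>B. finite B \<and> card B = k \<and> vec.independent B \<and>
      (\<forall>b\<in>B. norm b = 1 \<and> (\<exists>m. gram A *v b = m *\<^sub>R b))" if "k \<le> CARD('n)" for k
    using that
  proof (induction k)
    case 0
    show ?case by (rule exI[of _ "{}"]) (simp add: vec.independent_empty)
  next
    case (Suc k)
    then obtain B where B: "finite B" "card B = k" "vec.independent B"
      "\<And>b. b \<in> B \<Longrightarrow> norm b = 1" "\<forall>b\<in>B. \<exists>m. gram A *v b = m *\<^sub>R b"
      by auto
    have "vec.span B \<noteq> UNIV"
    proof
      assume "vec.span B = UNIV"
      then have "CARD('n) = card B"
        using vec.dim_span_eq_card_independent[OF B(3)] by (simp add: card_cart_basis)
      then show False using B(2) Suc.prems by simp
    qed
    then have ne: "kperp B \<noteq> {0}" by (rule kperp_nontrivial)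
    obtain x l where x: "x \<in> kperp B" "norm x = 1" "gram A *v x = l *\<^sub>R x"
      by (rule eigenvector_in_kperp[OF B(5) ne]) (rule that)
    have "x \<notin> vec.span B"
      using inner_kperp_span[OF x(1), of x] x(2) by auto
    moreover from this have "x \<notin> B" using vec.span_base by blast
    ultimately show ?case
      using B x by (intro exI[of _ "insert x B"]) (auto simp: vec.independent_insert)
  qed
  from this[of "CARD('n)"] obtain B where B: "finite B" "card B = CARD('n)" "vec.independent B"
    "\<And>b. b \<in> B \<Longrightarrow> norm b = 1" "\<forall>b\<in>B. \<exists>m. gram A *v b = m *\<^sub>R b" by auto
  from bchoice[OF B(5)] obtain \<mu> where "\<forall>b\<in>B. gram A *v b = \<mu> b *\<^sub>R b" by blast
  then show thesis using that B by blast
qed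

lemma eigenspace_eq_span:
  fixes A :: "'k::real_complex_field^'m^'n"
  assumes B: "finite B" "card B = CARD('n)" "vec.independent B"
    and eig: "\<And>b. b \<in> B \<Longrightarrow> gram A *v b = \<mu> b *\<^sub>R b"
  shows "{v. gram A *v v = of_real l *s v} = vec.span {b \<in> B. \<mu> b = l}" (is "?V = vec.span ?B")
proof
  have sub: "vec.subspace ?V"
    by (rule vec.subspaceI)
      (simp_all add: matrix_vector_right_distrib vector_add_ldistrib vector_scalar_commute
        vector_smult_assoc mult.commute)
  have "?B \<subseteq> ?V" using eig by (auto simp: scaleR_eq_vec_scale)
  then show "vec.span ?B \<subseteq> ?V" using sub by (rule vec.span_minimal)
  show "?V \<subseteq> vec.span ?B"
  proof
    fix v assume v: "v \<in> ?V"
    have "UNIV \<subseteq> vec.span B"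
      using B by (intro vec.card_ge_dim_independent) (simp_all add: card_cart_basis)
    then obtain a where a: "v = (\<Sum>b\<in>B. a b *s b)"
      using vec.span_finite[OF B(1)] by blast
    have "gram A *v v = (\<Sum>b\<in>B. gram A *v (a b *s b))"
      unfolding a by (simp add: linear_sum[OF linear_matrix_vector_mult])
    also have "\<dots> = (\<Sum>b\<in>B. (of_real (\<mu> b) * a b) *s b)"
      by (intro sum.cong)
        (simp_all add: vector_scalar_commute eig scaleR_eq_vec_scale vector_smult_assoc mult.commute)
    finally have "(\<Sum>b\<in>B. (of_real (\<mu> b) * a b) *s b) = of_real l *s v" using v by simp
    also have "\<dots> = (\<Sum>b\<in>B. (of_real l * a b) *s b)"
      unfolding a by (simp add: vec.scale_sum_right vector_smult_assoc)
    finally have "(\<Sum>b\<in>B. ((of_real (\<mu> b) - of_real l) * a b) *s b) = 0"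
      by (simp add: left_diff_distrib vector_sub_rdistrib sum_subtractf)
    then have "(of_real (\<mu> b) - of_real l) * a b = 0" if "b \<in> B" for b
      using vec.independentD[OF B(3) B(1) order_refl, of "\<lambda>b. (of_real (\<mu> b) - of_real l) * a b"] that
      by simp
    then have "\<mu> b = l \<or> a b = 0" if "b \<in> B" for b
      using that by (force simp flip: of_real_diff)
    then have "a b *s b \<in> vec.span ?B" if "b \<in> B" for b
      using that by (cases "a b = 0") (auto intro: vec.span_scale vec.span_base simp: vec.span_zero)
    then show "v \<in> vec.span ?B" unfolding a by (intro vec.span_sum) auto
  qed
qed

text \<open>The multiplicities defining the list of singular values are dimensions of eigenspaces; this
identifies the list with the one read off from a basis of eigenvectors. In particular it has as
many entries as the matrix has rows, so that the last one, \<open>sigma_min\<close>, is a genuine entry.\<close>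
lemma singular_values_eigenbasis:
  fixes A :: "'k::real_complex_field^'m^'n"
  assumes B: "finite B" "card B = CARD('n)" "vec.independent B"
    and nrm: "\<And>b. b \<in> B \<Longrightarrow> norm b = 1"
    and eig: "\<And>b. b \<in> B \<Longrightarrow> gram A *v b = \<mu> b *\<^sub>R b"
  shows "singular_values A
    = rev (sorted_list_of_multiset (image_mset (\<lambda>b. sqrt (\<mu> b)) (mset_set B)))"
proof -
  let ?g = "\<lambda>b. sqrt (\<mu> b)"
  have \<mu>: "\<mu> b \<ge> 0" if "b \<in> B" for b
    using gram_eigenvalue[OF eig nrm] that by simp
  have mult: "sv_mult A s = card {b \<in> B. ?g b = s}" for s
  proof (cases "s \<ge> 0")
    case True
    have "vec.independent {b \<in> B. \<mu> b = s\<^sup>2}"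
      by (rule vec.independent_mono[OF B(3)]) auto
    then have "sv_mult A s = card {b \<in> B. \<mu> b = s\<^sup>2}"
      using True eigenspace_eq_span[OF B eig, of "s\<^sup>2"]
      by (simp add: sv_mult_def vec.dim_eq_card_independent del: of_real_power flip: gram_def)
    also have "{b \<in> B. \<mu> b = s\<^sup>2} = {b \<in> B. ?g b = s}"
      using \<mu> True by (auto simp: real_sqrt_unique)
    finally show ?thesis .
  next
    case False
    then have "{b \<in> B. ?g b = s} = {}" using \<mu> by auto
    then have "card {b \<in> B. ?g b = s} = 0" by (simp only: card.empty)
    then show ?thesis using False unfolding sv_mult_def by (simp only: if_False)
  qed
  have S: "{s. sv_mult A s > 0} = ?g ` B"
    using B(1) by (auto simp: mult card_gt_0_iff)
  have "(\<Sum>s | sv_mult A s > 0. replicate_mset (sv_mult A s) s) = image_mset ?g (mset_set B)"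
  proof (rule multiset_eqI)
    fix x
    have "count (\<Sum>s | sv_mult A s > 0. replicate_mset (sv_mult A s) s) x
        = (\<Sum>s\<in>?g ` B. if s = x then sv_mult A x else 0)"
      unfolding S count_sum by (intro sum.cong) auto
    also have "\<dots> = sv_mult A x"
      using B(1) S by (auto simp: sum.delta)
    also have "\<dots> = (\<Sum>b | b \<in> B \<and> x = ?g b. 1)"
      by (simp add: mult eq_commute)
    also have "\<dots> = count (image_mset ?g (mset_set B)) x"
      using B(1) by (simp add: count_image_mset')
    finally show "count (\<Sum>s | sv_mult A s > 0. replicate_mset (sv_mult A s) s) x
        = count (image_mset ?g (mset_set B)) x" .
  qed
  then show ?thesis by (simp add: singular_values_def)
qed

lemma sigma_min_eigenbasis:
  fixes A :: "'k::real_complex_field^'m^'n"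
  assumes B: "finite B" "card B = CARD('n)" "vec.independent B"
    and nrm: "\<And>b. b \<in> B \<Longrightarrow> norm b = 1"
    and eig: "\<And>b. b \<in> B \<Longrightarrow> gram A *v b = \<mu> b *\<^sub>R b"
  shows "\<exists>b\<in>B. sigma_min A = sqrt (\<mu> b)" and "b \<in> B \<Longrightarrow> sigma_min A \<le> sqrt (\<mu> b)"
proof -
  define xs where "xs = sorted_list_of_multiset (image_mset (\<lambda>b. sqrt (\<mu> b)) (mset_set B))"
  have len: "length xs = CARD('n)"
    using B by (simp add: xs_def flip: size_mset)
  have set: "set xs = (\<lambda>b. sqrt (\<mu> b)) ` B"
    using B(1) by (simp add: xs_def)
  have srt: "sorted xs" by (simp add: xs_def)
  have ne: "CARD('n) > 0" by simp
  have "sigma_min A = rev xs ! (CARD('n) - 1)"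
    using singular_values_eigenbasis[OF assms] by (simp add: sigma_min_def sigma_def xs_def)
  then have s: "sigma_min A = xs ! 0"
    using len ne by (simp add: rev_nth)
  show "\<exists>b\<in>B. sigma_min A = sqrt (\<mu> b)"
    using s nth_mem[of 0 xs] len ne set by auto
  assume "b \<in> B"
  then obtain i where "i < length xs" "xs ! i = sqrt (\<mu> b)"
    using set by (metis imageI in_set_conv_nth)
  then show "sigma_min A \<le> sqrt (\<mu> b)"
    using s sorted_nth_mono[OF srt, of 0 i] by simp
qed

lemma sigma_min_nonneg: "sigma_min (A :: 'k::real_complex_field^'m^'n) \<ge> 0"
proof -
  obtain B \<mu> where B: "finite B" "card B = CARD('n)" "vec.independent B"
    "\<And>b. b \<in> B \<Longrightarrow> norm b = 1" "\<And>b. b \<in> B \<Longrightarrow> gram A *v b = \<mu> b *\<^sub>R b"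
    using gram_eigenbasis[of A] by blast
  obtain b where b: "b \<in> B" "sigma_min A = sqrt (\<mu> b)"
    using sigma_min_eigenbasis(1)[OF B] by blast
  then have "\<mu> b \<ge> 0" using gram_eigenvalue[OF B(5) B(4)] by simp
  then show ?thesis using b(2) by simp
qed

lemma sigma_min_eigenvector:
  fixes A :: "'k::real_complex_field^'m^'n"
  obtains x where "norm x = 1" "gram A *v x = (sigma_min A)\<^sup>2 *\<^sub>R x"
proof -
  obtain B \<mu> where B: "finite B" "card B = CARD('n)" "vec.independent B"
    "\<And>b. b \<in> B \<Longrightarrow> norm b = 1" "\<And>b. b \<in> B \<Longrightarrow> gram A *v b = \<mu> b *\<^sub>R b"
    using gram_eigenbasis[of A] by blast
  obtain b where b: "b \<in> B" "sigma_min A = sqrt (\<mu> b)"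
    using sigma_min_eigenbasis(1)[OF B] by blast
  then have "\<mu> b \<ge> 0" using gram_eigenvalue[OF B(5) B(4)] by simp
  then show thesis using that[of b] B(4,5) b by simp
qed

text \<open>The minimum of \<open>|A\<^sup>* y|\<^sup>2\<close> over unit vectors is an eigenvalue of \<open>A A\<^sup>*\<close>, hence the square of one
of the singular values.\<close>
lemma sigma_min_le:
  fixes A :: "'k::real_complex_field^'m^'n"
  shows "(sigma_min A)\<^sup>2 * (norm y)\<^sup>2 \<le> (norm (adjoint_mat A *v y))\<^sup>2"
proof -
  obtain B \<mu> where B: "finite B" "card B = CARD('n)" "vec.independent B"
    "\<And>b. b \<in> B \<Longrightarrow> norm b = 1" "\<And>b. b \<in> B \<Longrightarrow> gram A *v b = \<mu> b *\<^sub>R b"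
    using gram_eigenbasis[of A] by blast
  have perp: "kperp {} = (UNIV :: ('k^'n) set)" by (simp add: kperp_def)
  have "(\<chi> i. 1) \<noteq> (0 :: 'k^'n)" by (simp add: vec_eq_iff)
  then have ne: "kperp {} \<noteq> {0 :: 'k^'n}" unfolding perp by (metis UNIV_I singletonD)
  obtain x l where x: "norm x = 1" "gram A *v x = l *\<^sub>R x"
    and "\<forall>y\<in>kperp {}. l * (norm y)\<^sup>2 \<le> (norm (adjoint_mat A *v y))\<^sup>2"
    by (rule eigenvector_in_kperp[of "{}" A, OF _ ne]) (simp, rule that)
  then have l: "l * (norm y)\<^sup>2 \<le> (norm (adjoint_mat A *v y))\<^sup>2"
    by (simp add: perp)
  have "x \<in> vec.span {b \<in> B. \<mu> b = l}"
    using x(2) eigenspace_eq_span[OF B(1-3,5), of l] by (auto simp: scaleR_eq_vec_scale)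
  moreover have "x \<noteq> 0" using x(1) by auto
  ultimately have "{b \<in> B. \<mu> b = l} \<noteq> {}" by force
  then obtain b where b: "b \<in> B" "\<mu> b = l" by blast
  have "l \<ge> 0" using gram_eigenvalue[OF x(2,1)] by simp
  then have "(sigma_min A)\<^sup>2 \<le> l"
    using sigma_min_eigenbasis(2)[OF B b(1)] b(2) sigma_min_nonneg[of A]
    by (metis power_mono real_sqrt_pow2)
  then show ?thesis using l by (meson mult_right_mono order_trans zero_le_power2)
qed

text \<open>A zero singular value gives \<open>x \<noteq> 0\<close> with \<open>A\<^sup>* x = 0\<close>, and conjugating this equation turns it into
a linear dependence of the rows of \<open>A\<close>.\<close>
lemma sigma_min_pos:
  fixes A :: "'k::real_complex_field^'m^'n"
  assumes "A \<in> GL"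
  shows "sigma_min A > 0"
proof (rule ccontr)
  assume "\<not> ?thesis"
  then have "sigma_min A = 0" using sigma_min_nonneg[of A] by simp
  then obtain x where x: "norm x = 1" "gram A *v x = 0 *\<^sub>R x"
    using sigma_min_eigenvector[of A] by (metis power_zero_numeral)
  then have 0: "adjoint_mat A *v x = 0" using gram_eigenvalue[OF x(2,1)] by simp
  have "x \<noteq> 0" using x(1) by auto
  then obtain k where k: "x $ k \<noteq> 0" by (auto simp: vec_eq_iff)
  let ?c = "\<lambda>i. conjugate (x $ i)"
  have "(\<Sum>i\<in>UNIV. ?c i *s row i A) = 0"
  proof (rule vec_eq_iff[THEN iffD2], rule allI)
    fix j
    have "conjugate ((adjoint_mat A *v x) $ j) = (\<Sum>i\<in>UNIV. ?c i * A $ i $ j)"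
      by (simp add: matrix_vector_mult_def adjoint_mat_nth sum_conjugate conjugate_dist_mul mult.commute)
    then show "(\<Sum>i\<in>UNIV. ?c i *s row i A) $ j = 0 $ j" by (simp add: 0 row_def)
  qed
  then have eq: "?c k *s row k A = - (\<Sum>i\<in>-{k}. ?c i *s row i A)"
    by (simp add: sum.remove[of UNIV k] Compl_eq_Diff_UNIV eq_neg_iff_add_eq_0)
  let ?R = "(\<lambda>i. row i A) ` (-{k})"
  have "?c k *s row k A \<in> vec.span ?R"
    unfolding eq by (intro vec.span_neg vec.span_sum vec.span_scale vec.span_base) auto
  then have "inverse (?c k) *s (?c k *s row k A) \<in> vec.span ?R" by (rule vec.span_scale)
  then have "row k A \<in> vec.span ?R" using k by (simp add: vector_smult_assoc)
  then have "rows A \<subseteq> vec.span ?R" by (auto simp: rows_def intro: vec.span_base)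
  then have "rank A \<le> card ?R"
    unfolding row_rank_def_gen by (intro vec.dim_le_card) auto
  also have "\<dots> \<le> card (-{k})" by (rule card_image_le) simp
  also have "\<dots> < CARD('n)" by (simp add: Compl_eq_Diff_UNIV card_Diff_singleton_if)
  finally show False using assms by (simp add: GL_def)
qed

text \<open>This is where the simplicity of the smallest singular value enters: the minimum over the
complement of its eigenvector is another eigenvalue, and if it were the same, the eigenspace would
be at least two-dimensional.\<close>
lemma sigma_min_gap:
  fixes A :: "'k::real_complex_field^'m^'n"
  assumes A: "A \<in> GL_gt" and x: "norm x = 1" "gram A *v x = (sigma_min A)\<^sup>2 *\<^sub>R x"
  obtains d where "d > 0"
    "\<And>y. y \<in> kperp {x} \<Longrightarrow> ((sigma_min A)\<^sup>2 + d) * (norm y)\<^sup>2 \<le> (norm (adjoint_mat A *v y))\<^sup>2"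
proof (cases "kperp {x} = {0}")
  case True
  then show thesis using that[of 1] by simp
next
  case False
  obtain z l where z: "z \<in> kperp {x}" "norm z = 1" "gram A *v z = l *\<^sub>R z"
    and l: "\<forall>y\<in>kperp {x}. l * (norm y)\<^sup>2 \<le> (norm (adjoint_mat A *v y))\<^sup>2"
    by (rule eigenvector_in_kperp[OF _ False, of A]) (use x(2) in blast, rule that)
  have "l = (norm (adjoint_mat A *v z))\<^sup>2" using gram_eigenvalue[OF z(3,2)] .
  then have "(sigma_min A)\<^sup>2 \<le> l" using sigma_min_le[of A z] z(2) by simp
  moreover have "l \<noteq> (sigma_min A)\<^sup>2"
  proof
    assume eq: "l = (sigma_min A)\<^sup>2"
    let ?V = "{v. (A ** adjoint_mat A) *v v = of_real ((sigma_min A)\<^sup>2) *s v}"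
    have "{x, z} \<subseteq> ?V"
      using x(2) z(3) eq by (simp add: scaleR_eq_vec_scale gram_def)
    moreover have nz: "z \<notin> vec.span {x}" using inner_kperp_span[OF z(1), of z] z(2) by auto
    moreover have "x \<noteq> 0" using x(1) by auto
    ultimately have "card {x, z} \<le> vec.dim ?V"
      by (intro vec.independent_card_le_dim) (auto simp: insert_commute[of x z] vec.independent_insert)
    moreover have "vec.dim ?V = 1"
      using A sigma_min_nonneg[of A] by (simp add: GL_gt_def sv_mult_def)
    moreover have "x \<noteq> z" using nz vec.span_base[of z "{z}"] by auto
    ultimately show False by simp
  qed
  ultimately show thesis using that[of "l - (sigma_min A)\<^sup>2"] l by simp
qed

section \<open>The derivative of the square of the smallest singular value\<close>

lemma inner_vec_scale_both:
  fixes a p :: "'k::real_complex_field^'n"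
  shows "(c *s a) \<bullet> (c *s p) = (norm c)\<^sup>2 * (a \<bullet> p)"
proof -
  have "(c *s a) \<bullet> (c *s p)
      = ((norm (c *s (a + p)))\<^sup>2 - (norm (c *s a))\<^sup>2 - (norm (c *s p))\<^sup>2) / 2"
    by (simp only: dot_norm vector_add_ldistrib)
  also have "\<dots> = (norm c)\<^sup>2 * (((norm (a + p))\<^sup>2 - (norm a)\<^sup>2 - (norm p)\<^sup>2) / 2)"
    by (simp only: norm_vec_scale power_mult_distrib) (simp add: field_simps)
  finally show ?thesis by (simp only: dot_norm)
qed

lemma kperp_singleton_decomp:
  fixes x y :: "'k::real_complex_field^'n"
  obtains c z where "y = c *s x + z" "z \<in> kperp {x}"
proof -
  obtain p z where p: "p \<in> vec.span {x}" and z: "\<And>w. w \<in> vec.span {x} \<Longrightarrow> orthogonal z w"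
    and y: "y = p + z"
    using orthogonal_subspace_decomp_exists[of "vec.span {x}" y] unfolding span_vec_span by metis
  have "z \<in> kperp {x}"
    using z by (simp add: kperp_def orthogonal_def vec.span_scale vec.span_base)
  moreover obtain c where "p = c *s x" using p by (auto simp: vec.span_singleton)
  ultimately show thesis using that y by blast
qed

text \<open>Perturbation of a simple eigenvalue. The upper bound comes from testing the minimum for \<open>A + E\<close>
with the eigenvector \<open>x\<close> of \<open>A\<close>. For the lower bound, split a minimizer for \<open>A + E\<close> as
\<open>y = c x + z\<close> with \<open>z\<close> orthogonal to \<open>x\<close>. The component \<open>z\<close> raises \<open>|A\<^sup>* y|\<^sup>2\<close> by at least
\<open>d |z|\<^sup>2\<close>, where \<open>d\<close> is the spectral gap, whereas it changes the first order term by at most a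
multiple of \<open>|A| |E| |z|\<close>. Completing the square bounds the possible loss by a multiple of
\<open>|E|\<^sup>2 / d\<close>, whatever \<open>z\<close> is, so the convergence of eigenvectors does not have to be studied.\<close>
lemma sigma_min_sq_expansion:
  fixes A :: "'k::real_complex_field^'m^'n"
  assumes A: "A \<in> GL_gt" and x: "norm x = 1" "gram A *v x = (sigma_min A)\<^sup>2 *\<^sub>R x"
  obtains C where "\<And>E. \<bar>(sigma_min (A + E))\<^sup>2 - (sigma_min A)\<^sup>2
      - 2 * (outer x (adjoint_mat A *v x) \<bullet> E)\<bar> \<le> C * (norm E)\<^sup>2"
proof -
  define h where "h = (sigma_min A)\<^sup>2"
  define K where "K = norm A"
  obtain d where d: "d > 0" and gap:
    "\<And>y. y \<in> kperp {x} \<Longrightarrow> (h + d) * (norm y)\<^sup>2 \<le> (norm (adjoint_mat A *v y))\<^sup>2"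
    using sigma_min_gap[OF A x] by (metis h_def)
  define a where "a = adjoint_mat A *v x"
  have aa: "(norm a)\<^sup>2 = h" using gram_eigenvalue[OF x(2,1)] by (simp add: a_def h_def)
  have K0: "K \<ge> 0" by (simp add: K_def)
  have expand: "(norm (adjoint_mat (A + E) *v y))\<^sup>2 = (norm (adjoint_mat A *v y))\<^sup>2
      + 2 * ((adjoint_mat A *v y) \<bullet> (adjoint_mat E *v y)) + (norm (adjoint_mat E *v y))\<^sup>2" for E y
    by (simp add: linear_add[OF linear_adjoint_mult] power2_norm_eq_inner inner_add_left
        inner_add_right inner_commute)
  have upper: "(sigma_min (A + E))\<^sup>2 - h - 2 * (outer x a \<bullet> E) \<le> (norm E)\<^sup>2" for E
  proof -
    have "(sigma_min (A + E))\<^sup>2 \<le> (norm (adjoint_mat (A + E) *v x))\<^sup>2"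
      using sigma_min_le[of "A + E" x] x(1) by simp
    moreover have "(norm (adjoint_mat E *v x))\<^sup>2 \<le> (norm E)\<^sup>2"
      using norm_adjoint_mult_le[of E x] x(1) by simp
    moreover have "outer x a \<bullet> E = a \<bullet> (adjoint_mat E *v x)"
      by (subst inner_outer) (rule inner_commute)
    ultimately show ?thesis
      unfolding expand a_def[symmetric] aa by linarith
  qed
  have lower: "h + 2 * (outer x a \<bullet> E) - 16 * K\<^sup>2 / d * (norm E)\<^sup>2 \<le> (sigma_min (A + E))\<^sup>2" for E
  proof -
    obtain y where y: "norm y = 1" "gram (A + E) *v y = (sigma_min (A + E))\<^sup>2 *\<^sub>R y"
      using sigma_min_eigenvector[of "A + E"] by blast
    obtain c z where yc: "y = c *s x + z" and z: "z \<in> kperp {x}"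
      by (rule kperp_singleton_decomp)
    define e where "e = norm E"
    define \<zeta> where "\<zeta> = norm z"
    define p q w where "p = adjoint_mat E *v x" and "q = adjoint_mat E *v z"
      and "w = adjoint_mat A *v z"
    have xz: "(c *s x) \<bullet> z = 0" using z by (simp add: kperp_def inner_commute)
    have one: "(norm c)\<^sup>2 + \<zeta>\<^sup>2 = 1"
    proof -
      have "1 = (norm (c *s x + z))\<^sup>2" using y(1) yc by simp
      also have "\<dots> = (norm (c *s x))\<^sup>2 + \<zeta>\<^sup>2"
        using xz by (simp add: power2_norm_eq_inner inner_add_left inner_add_right inner_commute \<zeta>_def)
      finally show ?thesis using x(1) by (simp add: norm_vec_scale)
    qed
    then have c2: "(norm c)\<^sup>2 = 1 - \<zeta>\<^sup>2" by simp
    have c1: "norm c \<le> 1"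
    proof (rule power2_le_imp_le)
      have "(norm c)\<^sup>2 \<le> 1" using one zero_le_power2[of \<zeta>] by linarith
      then show "(norm c)\<^sup>2 \<le> 1\<^sup>2" by (simp only: one_power2)
    qed simp
    have \<zeta>: "0 \<le> \<zeta>" by (simp add: \<zeta>_def)
    have \<zeta>1: "\<zeta> \<le> 1"
    proof (rule power2_le_imp_le)
      have "\<zeta>\<^sup>2 \<le> 1" using one zero_le_power2[of "norm c"] by linarith
      then show "\<zeta>\<^sup>2 \<le> 1\<^sup>2" by (simp only: one_power2)
    qed simp
    note \<zeta> = \<zeta> \<zeta>1
    have Ay: "adjoint_mat A *v y = c *s a + w"
      by (simp add: yc matrix_vector_right_distrib vector_scalar_commute a_def w_def)
    have Ey: "adjoint_mat E *v y = c *s p + q"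
      by (simp add: yc matrix_vector_right_distrib vector_scalar_commute p_def q_def)
    have "(c *s a) \<bullet> w = (gram A *v (c *s x)) \<bullet> z"
      unfolding a_def w_def vector_scalar_commute[symmetric] by (rule inner_gram[symmetric])
    also have "gram A *v (c *s x) = h *\<^sub>R (c *s x)"
      by (simp add: vector_scalar_commute x(2) h_def scaleR_eq_vec_scale vector_smult_assoc mult.commute)
    finally have aw: "(c *s a) \<bullet> w = 0" using xz by simp
    have "(norm (adjoint_mat A *v y))\<^sup>2 = (norm (c *s a))\<^sup>2 + (norm w)\<^sup>2"
      using aw by (simp add: Ay power2_norm_eq_inner inner_add_left inner_add_right inner_commute)
    also have "\<dots> \<ge> (norm c)\<^sup>2 * h + (h + d) * \<zeta>\<^sup>2"
      using gap[OF z] by (simp add: norm_vec_scale power_mult_distrib aa w_def \<zeta>_def)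
    also have "(norm c)\<^sup>2 * h + (h + d) * \<zeta>\<^sup>2 = ((norm c)\<^sup>2 + \<zeta>\<^sup>2) * h + d * \<zeta>\<^sup>2"
      by (simp add: algebra_simps)
    finally have Asq: "(norm (adjoint_mat A *v y))\<^sup>2 \<ge> h + d * \<zeta>\<^sup>2"
      unfolding one by simp
    have ba: "norm a \<le> K" and bp: "norm p \<le> e"
      using norm_adjoint_mult_le[of A x] norm_adjoint_mult_le[of E x] x(1)
      by (simp_all add: a_def p_def K_def e_def)
    have bw: "norm w \<le> K * \<zeta>" and bq: "norm q \<le> e * \<zeta>"
      using norm_adjoint_mult_le[of A z] norm_adjoint_mult_le[of E z]
      by (simp_all add: w_def q_def K_def e_def \<zeta>_def)
    have e0: "e \<ge> 0" by (simp add: e_def)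
    have t1: "\<bar>(c *s a) \<bullet> q\<bar> \<le> K * (e * \<zeta>)"
    proof -
      have "norm (c *s a) \<le> 1 * K"
        unfolding norm_vec_scale using c1 ba by (intro mult_mono) auto
      then have "norm (c *s a) * norm q \<le> K * (e * \<zeta>)" using bq K0 by (intro mult_mono) auto
      then show ?thesis using Cauchy_Schwarz_ineq2 order_trans by blast
    qed
    have t2: "\<bar>w \<bullet> (c *s p)\<bar> \<le> (K * \<zeta>) * e"
    proof -
      have "norm (c *s p) \<le> 1 * e"
        unfolding norm_vec_scale using c1 bp by (intro mult_mono) auto
      then have "norm w * norm (c *s p) \<le> (K * \<zeta>) * e" using bw K0 \<zeta> by (intro mult_mono) auto
      then show ?thesis using Cauchy_Schwarz_ineq2 order_trans by blast
    qed
    have t3: "\<bar>w \<bullet> q\<bar> \<le> K * e * \<zeta>"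
    proof -
      have "norm w * norm q \<le> (K * \<zeta>) * (e * \<zeta>)" using bw bq K0 \<zeta> by (intro mult_mono) auto
      also have "\<dots> = K * e * (\<zeta> * \<zeta>)" by simp
      also have "\<dots> \<le> K * e * (\<zeta> * 1)" using K0 e0 \<zeta> by (intro mult_left_mono) auto
      finally show ?thesis using Cauchy_Schwarz_ineq2[of w q] by simp
    qed
    \<comment> \<open>the loss from \<open>|c|\<^sup>2 = 1 - \<zeta>\<^sup>2\<close> in the main term\<close>
    have t4: "\<zeta>\<^sup>2 * (a \<bullet> p) \<le> K * e * \<zeta>"
    proof -
      have "a \<bullet> p \<le> K * e"
        using norm_cauchy_schwarz[of a p] mult_mono[OF ba bp K0] by simp
      then have "\<zeta>\<^sup>2 * (a \<bullet> p) \<le> \<zeta>\<^sup>2 * (K * e)" by (simp add: mult_left_mono)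
      also have "\<dots> \<le> \<zeta> * (K * e)"
        using \<zeta> K0 e0 by (intro mult_right_mono) (auto simp: power2_eq_square mult_left_le)
      finally show ?thesis by (simp add: mult_ac)
    qed
    have "(adjoint_mat A *v y) \<bullet> (adjoint_mat E *v y)
        = (norm c)\<^sup>2 * (a \<bullet> p) + (c *s a) \<bullet> q + w \<bullet> (c *s p) + w \<bullet> q"
      by (simp add: Ay Ey inner_add_left inner_add_right inner_vec_scale_both)
    moreover have "(norm c)\<^sup>2 * (a \<bullet> p) = a \<bullet> p - \<zeta>\<^sup>2 * (a \<bullet> p)"
      unfolding c2 by (simp add: left_diff_distrib)
    ultimately have cross:
      "a \<bullet> p - 4 * (K * e * \<zeta>) \<le> (adjoint_mat A *v y) \<bullet> (adjoint_mat E *v y)"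
      using t1 t2 t3 t4 by (simp add: abs_le_iff mult_ac)
    \<comment> \<open>completing the square: the minimum over \<open>\<zeta>\<close> of \<open>d \<zeta>\<^sup>2 - 8 K e \<zeta>\<close>\<close>
    have "0 \<le> (d * \<zeta> - 4 * K * e)\<^sup>2 / d" using d by simp
    also have "\<dots> = d * \<zeta>\<^sup>2 - 8 * (K * e * \<zeta>) + 16 * K\<^sup>2 / d * e\<^sup>2"
      using d by (simp add: power2_eq_square field_simps)
    finally have "- (16 * K\<^sup>2 / d * e\<^sup>2) \<le> d * \<zeta>\<^sup>2 - 8 * (K * e * \<zeta>)" by simp
    moreover have "(sigma_min (A + E))\<^sup>2 = (norm (adjoint_mat (A + E) *v y))\<^sup>2"
      using gram_eigenvalue[OF y(2,1)] .
    moreover have "outer x a \<bullet> E = a \<bullet> p"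
      unfolding inner_outer p_def by (rule inner_commute)
    ultimately show ?thesis
      using Asq cross unfolding expand e_def[symmetric]
      by (smt (verit) zero_le_power2)
  qed
  show thesis
  proof (rule that)
    fix E :: "'k^'m^'n"
    have "16 * K\<^sup>2 / d * (norm E)\<^sup>2 \<ge> 0" using d by simp
    then show "\<bar>(sigma_min (A + E))\<^sup>2 - (sigma_min A)\<^sup>2
      - 2 * (outer x (adjoint_mat A *v x) \<bullet> E)\<bar> \<le> (1 + 16 * K\<^sup>2 / d) * (norm E)\<^sup>2"
      using upper[of E] lower[of E] unfolding distrib_right h_def a_def
      by (smt (verit) zero_le_power2 mult_1)
  qed
qed

lemma has_derivative_quadratic_remainder:
  fixes f :: "'a::real_normed_vector \<Rightarrow> 'b::real_normed_vector"
  assumes D: "bounded_linear D"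
    and rem: "\<And>e. norm (f (a + e) - f a - D e) \<le> C * (norm e)\<^sup>2"
  shows "(f has_derivative D) (at a)"
proof -
  have "((\<lambda>e::'a. C * norm e) \<longlongrightarrow> C * norm (0::'a)) (at 0)"
    by (intro tendsto_intros)
  then have lim: "((\<lambda>e::'a. C * norm e) \<longlongrightarrow> 0) (at 0)" by simp
  have "((\<lambda>e. norm (f (a + e) - f a - D e) / norm e) \<longlongrightarrow> 0) (at 0)"
  proof (rule tendsto_sandwich[OF _ _ tendsto_const lim])
    show "\<forall>\<^sub>F e in at 0. norm (f (a + e) - f a - D e) / norm e \<le> C * norm e"
      using rem by (intro always_eventually allI)
        (auto simp: divide_le_eq power2_eq_square mult.assoc)
  qed auto
  then show ?thesis using D by (simp add: has_derivative_at)
qed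

lemma sigma_min_sq_has_derivative:
  fixes A :: "'k::real_complex_field^'m^'n"
  assumes "A \<in> GL_gt" "norm x = 1" "gram A *v x = (sigma_min A)\<^sup>2 *\<^sub>R x"
  shows "((\<lambda>X. (sigma_min X)\<^sup>2) has_derivative
    (\<lambda>E. 2 * (outer x (adjoint_mat A *v x) \<bullet> E))) (at A)"
proof -
  obtain C where "\<And>E. \<bar>(sigma_min (A + E))\<^sup>2 - (sigma_min A)\<^sup>2
      - 2 * (outer x (adjoint_mat A *v x) \<bullet> E)\<bar> \<le> C * (norm E)\<^sup>2"
    using sigma_min_sq_expansion[OF assms] by blast
  then show ?thesis
    by (intro has_derivative_quadratic_remainder[where C = C])
      (auto intro!: bounded_linear_const_mult bounded_linear_inner_right)
qed

section \<open>Geodesics of the condition metric\<close>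

text \<open>For a metric conformal to a constant one, the Koszul formula can be solved explicitly.\<close>
lemma christoffel_conformal:
  fixes f :: "'e::euclidean_space \<Rightarrow> real"
  assumes f: "(f has_derivative (\<lambda>u. G \<bullet> u)) (at p)" and pos: "f p > 0"
  shows "christoffel (\<lambda>q u w. f q * (u \<bullet> w)) p v v
    = inverse (f p) *\<^sub>R ((G \<bullet> v) *\<^sub>R v - ((norm v)\<^sup>2 / 2) *\<^sub>R G)"
proof (rule christoffel_unique)
  let ?g = "\<lambda>q u w :: 'e. f q * (u \<bullet> w)"
  have d: "metric_deriv ?g p u v w = (G \<bullet> u) * (v \<bullet> w)" for u v w
  proof -
    have "((\<lambda>q. f q * (v \<bullet> w)) has_derivative (\<lambda>u. (G \<bullet> u) * (v \<bullet> w))) (at p)"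
      by (rule has_derivative_mult_left[OF f])
    then show ?thesis by (simp add: metric_deriv_def frechet_derivative_at[symmetric])
  qed
  show "linear (\<lambda>z. f p * (z \<bullet> w))" for w
    by (rule linearI) (simp_all add: inner_add_left algebra_simps)
  show "z \<noteq> 0 \<Longrightarrow> f p * (z \<bullet> z) > 0" for z using pos by simp
  show "f p * ((inverse (f p) *\<^sub>R ((G \<bullet> v) *\<^sub>R v - ((norm v)\<^sup>2 / 2) *\<^sub>R G)) \<bullet> w)
      = christoffel1 ?g p v v w" for w
    using pos by (simp add: christoffel1_def d inner_diff_left power2_norm_eq_inner field_simps)
qed

lemma condition_metric_eq:
  "condition_metric = (\<lambda>A M N :: 'k::real_complex_field^'m^'n. inverse ((sigma_min A)\<^sup>2) * (M \<bullet> N))"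
  by (simp add: fun_eq_iff condition_metric_def re_part_frob)

lemma christoffel_condition_metric:
  fixes A :: "'k::real_complex_field^'m^'n"
  assumes A: "A \<in> GL_gt" and x: "norm x = 1" "gram A *v x = (sigma_min A)\<^sup>2 *\<^sub>R x"
  defines "G \<equiv> outer x (adjoint_mat A *v x)"
  shows "christoffel condition_metric A v v
    = ((norm v)\<^sup>2 / (sigma_min A)\<^sup>2) *\<^sub>R G - (2 * (G \<bullet> v) / (sigma_min A)\<^sup>2) *\<^sub>R v"
proof -
  define h where "h = (sigma_min A)\<^sup>2"
  have h: "h > 0" using A sigma_min_pos[of A] by (simp add: h_def GL_gt_def)
  define c where "c = - (2 / h\<^sup>2)"
  have "((\<lambda>X. inverse ((sigma_min X)\<^sup>2)) has_derivative
      (\<lambda>u. - (inverse ((sigma_min A)\<^sup>2) * (2 * (G \<bullet> u)) * inverse ((sigma_min A)\<^sup>2)))) (at A)"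
    unfolding G_def
    by (rule Deriv.has_derivative_inverse[OF _ sigma_min_sq_has_derivative[OF A x]])
      (use h in \<open>simp add: h_def\<close>)
  also have "(\<lambda>u. - (inverse ((sigma_min A)\<^sup>2) * (2 * (G \<bullet> u)) * inverse ((sigma_min A)\<^sup>2)))
      = (\<lambda>u. (c *\<^sub>R G) \<bullet> u)"
    by (simp add: fun_eq_iff c_def h_def divide_inverse power2_eq_square algebra_simps)
  finally have deriv: "((\<lambda>X. inverse ((sigma_min X)\<^sup>2)) has_derivative (\<lambda>u. (c *\<^sub>R G) \<bullet> u)) (at A)" .
  have "christoffel condition_metric A v v
      = h *\<^sub>R (((c *\<^sub>R G) \<bullet> v) *\<^sub>R v - ((norm v)\<^sup>2 / 2) *\<^sub>R (c *\<^sub>R G))"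
    using christoffel_conformal[OF deriv, of v] h by (simp add: condition_metric_eq h_def)
  also have "\<dots> = ((norm v)\<^sup>2 / h) *\<^sub>R G - (2 * (G \<bullet> v) / h) *\<^sub>R v"
    using h by (simp add: c_def scaleR_diff_right power2_eq_square)
  finally show ?thesis by (simp add: h_def)
qed

section \<open>Convexity by support from below\<close>

lemma local_max_second_derivative_nonpos:
  fixes M M' :: "real \<Rightarrow> real"
  assumes M: "\<forall>\<^sub>F s in nhds t. (M has_real_derivative M' s) (at s)"
    and M': "(M' has_real_derivative D) (at t)"
    and max: "\<forall>\<^sub>F s in nhds t. M s \<le> M t"
  shows "D \<le> 0"
proof (rule ccontr)
  assume "\<not> D \<le> 0"
  then have "D > 0" by simp
  obtain r where r: "r > 0" and M: "\<And>s. \<bar>s - t\<bar> < r \<Longrightarrow> (M has_real_derivative M' s) (at s)"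
    and max: "\<And>s. \<bar>s - t\<bar> < r \<Longrightarrow> M s \<le> M t"
    using eventually_conj[OF M max] unfolding eventually_nhds_metric dist_real_def by blast
  have "M' t = 0"
    by (rule DERIV_local_max[OF M r]) (use r max in \<open>auto simp: abs_minus_commute\<close>)
  obtain e where e: "e > 0" and inc: "\<And>h. 0 < h \<Longrightarrow> h < e \<Longrightarrow> M' t < M' (t + h)"
    using DERIV_pos_inc_right[OF M' \<open>D > 0\<close>] by blast
  define s where "s = t + min r e / 2"
  have s: "t < s" "s < t + r" "s < t + e" using r e by (auto simp: s_def min_def)
  obtain z where z: "t < z" "z < s" "M s - M t = (s - t) * M' z"
    using MVT2[OF s(1), of M M'] M s by force
  have "M' z > 0" using inc[of "z - t"] z s \<open>M' t = 0\<close> by simp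
  then have "(s - t) * M' z > 0" using s(1) by simp
  then have "M s > M t" using z(3) by simp
  then show False using max[of s] s by simp
qed

text \<open>A maximum principle: \<open>F\<close> itself need not be differentiable, as it is enough that at each interior
point it is touched from below by a function with nonnegative second derivative there. If \<open>F\<close> were
above a chord somewhere, then \<open>F\<close> minus the chord, bent upwards by a small multiple of a parabola
vanishing at the endpoints of the chord, would still have an interior maximum. There the supporting
function minus the same correction would have a local maximum and a positive second derivative.\<close>
lemma convex_on_if_supported_from_below:
  fixes F :: "real \<Rightarrow> real"
  assumes J: "is_interval J" and cont: "continuous_on J F"
    and supp: "\<And>t. t \<in> interior J \<Longrightarrow> \<exists>L L' D. L t = F t \<and> (\<forall>\<^sub>F s in nhds t. L s \<le> F s) \<and>
      (\<forall>\<^sub>F s in nhds t. (L has_real_derivative L' s) (at s)) \<and>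
      (L' has_real_derivative D) (at t) \<and> D \<ge> 0"
  shows "convex_on J F"
proof (rule convex_on_linorderI)
  show "convex J" using J by (simp add: is_interval_convex_1)
  fix u x y :: real
  assume u: "0 < u" "u < 1" and xy: "x \<in> J" "y \<in> J" "x < y"
  define c where "c = (1 - u) *\<^sub>R x + u *\<^sub>R y"
  have c: "c = x + u * (y - x)" by (simp add: c_def algebra_simps)
  have sub: "{x..y} \<subseteq> J" using J xy by (meson atLeastAtMost_iff mem_is_interval_1_I subsetI)
  show "F ((1 - u) *\<^sub>R x + u *\<^sub>R y) \<le> (1 - u) * F x + u * F y"
    unfolding c_def[symmetric]
  proof (rule ccontr)
    define m where "m = (F y - F x) / (y - x)"
    define \<delta> where "\<delta> = F c - ((1 - u) * F x + u * F y)"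
    \<comment> \<open>small enough that the correction \<open>\<epsilon> (t - x) (y - t)\<close> stays below the excess \<open>\<delta>\<close>\<close>
    define \<epsilon> where "\<epsilon> = \<delta> / (2 * (y - x)\<^sup>2)"
    define R where "R = (\<lambda>t. F x + m * (t - x) - \<epsilon> * ((t - x) * (t - y)))"
    assume "\<not> F c \<le> (1 - u) * F x + u * F y"
    then have \<delta>: "\<delta> > 0" by (simp add: \<delta>_def)
    then have \<epsilon>: "\<epsilon> > 0" using xy by (simp add: \<epsilon>_def)
    have my: "m * (y - x) = F y - F x" using xy by (simp add: m_def)
    have "m * (c - x) = u * (F y - F x)" by (simp add: c flip: my)
    moreover have "\<epsilon> * ((c - x) * (c - y)) = - (\<delta> / 2) * (u * (1 - u))"
    proof -
      have "(c - x) * (c - y) = - (u * (1 - u)) * (y - x)\<^sup>2"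
        by (simp add: c power2_eq_square algebra_simps)
      then have "\<epsilon> * ((c - x) * (c - y)) = - (u * (1 - u)) * (\<epsilon> * (y - x)\<^sup>2)"
        by simp
      also have "\<epsilon> * (y - x)\<^sup>2 = \<delta> / 2" using xy by (simp add: \<epsilon>_def)
      finally show ?thesis by simp
    qed
    ultimately have "F c - R c = \<delta> - \<delta> / 2 * (u * (1 - u))"
      by (simp add: R_def \<delta>_def algebra_simps)
    moreover have "u * (1 - u) \<le> 1 * 1" using u by (intro mult_mono) auto
    then have "\<delta> / 2 * (u * (1 - u)) \<le> \<delta> / 2 * 1" using \<delta> by (intro mult_left_mono) auto
    ultimately have gc: "F c - R c > 0" using \<delta> by simp
    have "continuous_on {x..y} (\<lambda>t. F t - R t)"
      unfolding R_def by (intro continuous_intros continuous_on_subset[OF cont sub])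
    then obtain t where t: "t \<in> {x..y}" and tmax: "\<And>s. s \<in> {x..y} \<Longrightarrow> F s - R s \<le> F t - R t"
      using continuous_attains_sup[of "{x..y}" "\<lambda>t. F t - R t"] xy(3) by auto
    have "c \<in> {x..y}" using u xy by (auto simp: c algebra_simps mult_left_le_one_le)
        (smt (verit) mult_left_le_one_le right_diff_distrib mult.commute)
    then have "F t - R t > 0" using tmax gc by fastforce
    moreover have "F x - R x = 0" "F y - R y = 0" by (simp_all add: R_def my)
    ultimately have txy: "t \<in> {x<..<y}" using t by (cases "t = x"; cases "t = y") auto
    moreover have "{x<..<y} \<subseteq> interior J"
      using sub by (intro interior_maximal) auto
    ultimately obtain L L' D where L: "L t = F t" "\<forall>\<^sub>F s in nhds t. L s \<le> F s"
      "\<forall>\<^sub>F s in nhds t. (L has_real_derivative L' s) (at s)"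
      "(L' has_real_derivative D) (at t)" "D \<ge> 0"
      using supp by blast
    have near: "\<forall>\<^sub>F s in nhds t. s \<in> {x<..<y}"
      using txy by (intro eventually_nhds_in_open) auto
    have "D + 2 * \<epsilon> \<le> 0"
    proof (rule local_max_second_derivative_nonpos)
      let ?M = "\<lambda>s. L s - R s" and ?M' = "\<lambda>s. L' s - (m - \<epsilon> * (2 * s - x - y))"
      show "\<forall>\<^sub>F s in nhds t. (?M has_real_derivative ?M' s) (at s)"
        using L(3)
      proof eventually_elim
        case (elim s)
        have "(R has_real_derivative (m - \<epsilon> * (2 * s - x - y))) (at s)"
          unfolding R_def by (auto intro!: derivative_eq_intros simp: algebra_simps)
        then show ?case using elim by (intro DERIV_diff)
      qed
      show "(?M' has_real_derivative D + 2 * \<epsilon>) (at t)"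
        using L(4) by (auto intro!: derivative_eq_intros)
      show "\<forall>\<^sub>F s in nhds t. ?M s \<le> ?M t"
        using L(2) near
      proof eventually_elim
        case (elim s)
        then show ?case using tmax[of s] L(1) by simp
      qed
    qed
    then show False using L(5) \<epsilon> by simp
  qed
qed

section \<open>Logarithmic convexity along geodesics\<close>

text \<open>Fix a time \<open>t\<close> and a unit eigenvector \<open>x\<close> for the smallest singular value of \<open>\<gamma> t\<close>. The function
\<open>- ln |\<gamma>(s)\<^sup>* x|\<^sup>2\<close> of \<open>s\<close> touches \<open>ln \<sigma>\<^sup>-\<^sup>2\<close> from below at \<open>t\<close>. When the geodesic equation
is inserted into its second derivative at \<open>t\<close>, the terms with the gradient of \<open>\<sigma>\<close> cancel and
\<open>2 (|v|\<^sup>2 - |v\<^sup>* x|\<^sup>2) / \<sigma>\<^sup>2\<close> remains, where \<open>v\<close> is the velocity.\<close>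
lemma log_convex_sigma_min:
  "log_convex (GL_gt :: ('k::real_complex_field^'m^'n) set) condition_metric
    (\<lambda>A. inverse ((sigma_min A)\<^sup>2))"
  unfolding log_convex_def
proof (intro allI impI)
  fix J and \<gamma> :: "real \<Rightarrow> 'k^'m^'n"
  assume "geodesic_on GL_gt condition_metric J \<gamma>"
  then obtain \<gamma>' \<gamma>'' where J: "is_interval J" and GL: "\<And>t. t \<in> J \<Longrightarrow> \<gamma> t \<in> GL_gt"
    and d1: "\<And>t. t \<in> J \<Longrightarrow> (\<gamma> has_vector_derivative \<gamma>' t) (at t within J)"
    and d2: "\<And>t. t \<in> J \<Longrightarrow> (\<gamma>' has_vector_derivative \<gamma>'' t) (at t within J)"
    and geo: "\<And>t. t \<in> J \<Longrightarrow> \<gamma>'' t + christoffel condition_metric (\<gamma> t) (\<gamma>' t) (\<gamma>' t) = 0"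
    unfolding geodesic_on_def by (auto simp: image_subset_iff)
  let ?h = "\<lambda>t. (sigma_min (\<gamma> t))\<^sup>2"
  have hpos: "?h t > 0" if "t \<in> J" for t
    using GL[OF that] sigma_min_pos[of "\<gamma> t"] by (simp add: GL_gt_def)
  show "convex_on J (\<lambda>t. ln (inverse (?h t)))"
  proof (rule convex_on_if_supported_from_below[OF J])
    have "continuous_on J ?h"
      unfolding continuous_on_eq_continuous_within
    proof
      fix t assume t: "t \<in> J"
      obtain x where "norm x = 1" "gram (\<gamma> t) *v x = ?h t *\<^sub>R x"
        using sigma_min_eigenvector[of "\<gamma> t"] by blast
      then have "isCont (\<lambda>X. (sigma_min X)\<^sup>2) (\<gamma> t)"
        using sigma_min_sq_has_derivative[OF GL[OF t]] has_derivative_continuous by blast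
      moreover have "continuous (at t within J) \<gamma>"
        using d1[OF t] has_vector_derivative_continuous by blast
      ultimately show "continuous (at t within J) ?h"
        using continuous_within_compose3 by blast
    qed
    moreover have "\<forall>t\<in>J. ?h t \<noteq> 0" using hpos by (metis less_irrefl)
    ultimately show "continuous_on J (\<lambda>t. ln (inverse (?h t)))"
      by (intro continuous_on_ln continuous_on_inverse ballI) simp_all
  next
    fix t assume ti: "t \<in> interior J"
    then have t: "t \<in> J" using interior_subset by blast
    obtain x where x: "norm x = 1" "gram (\<gamma> t) *v x = ?h t *\<^sub>R x"
      using sigma_min_eigenvector[of "\<gamma> t"] by blast
    define h v P P' P'' where "h = ?h t" and "v = \<gamma>' t"
      and "P = (\<lambda>s. adjoint_mat (\<gamma> s) *v x)" and "P' = (\<lambda>s. adjoint_mat (\<gamma>' s) *v x)"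
      and "P'' = adjoint_mat (\<gamma>'' t) *v x"
    define q q' where "q = (\<lambda>s. P s \<bullet> P s)" and "q' = (\<lambda>s. 2 * (P s \<bullet> P' s))"
    define D where "D = - ((2 * (P' t \<bullet> P' t + P t \<bullet> P'') * q t - q' t * q' t) / (q t * q t))"
    have bl: "bounded_linear (\<lambda>A :: 'k^'m^'n. adjoint_mat A *v x)"
      using linear_adjoint_mult linear_conv_bounded_linear by blast
    have atJ: "at s within J = at s" if "s \<in> interior J" for s
      using that by (rule at_within_interior)
    have dP: "(P has_vector_derivative P' s) (at s)" if "s \<in> interior J" for s
      using d1[of s] bounded_linear.has_vector_derivative[OF bl] that interior_subset atJ
      unfolding P_def P'_def by (metis subsetD)
    have dP': "(P' has_vector_derivative P'') (at t)"
      using d2[OF t] bounded_linear.has_vector_derivative[OF bl] atJ[OF ti]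
      unfolding P'_def P''_def by metis
    have qge: "?h s \<le> q s" for s
      using sigma_min_le[of "\<gamma> s" x] x(1) by (simp add: q_def P_def power2_norm_eq_inner)
    have qpos: "q s > 0" if "s \<in> J" for s using qge[of s] hpos[OF that] by linarith
    have qt: "q t = h"
      using gram_eigenvalue[OF x(2,1)] by (simp add: q_def P_def h_def power2_norm_eq_inner)
    have dq: "(q has_real_derivative q' s) (at s)" if "s \<in> interior J" for s
    proof -
      have "((\<lambda>s. P s \<bullet> P s) has_vector_derivative P s \<bullet> P' s + P' s \<bullet> P s) (at s)"
        by (rule bounded_bilinear.has_vector_derivative[OF bounded_bilinear_inner dP[OF that] dP[OF that]])
      then show ?thesis
        by (simp add: has_real_derivative_iff_has_vector_derivative q_def q'_def inner_commute)
    qed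
    have dq': "(q' has_real_derivative 2 * (P' t \<bullet> P' t + P t \<bullet> P'')) (at t)"
    proof -
      have "((\<lambda>s. P s \<bullet> P' s) has_vector_derivative P t \<bullet> P'' + P' t \<bullet> P' t) (at t)"
        by (rule bounded_bilinear.has_vector_derivative[OF bounded_bilinear_inner dP[OF ti] dP'])
      then have "((\<lambda>s. P s \<bullet> P' s) has_real_derivative P' t \<bullet> P' t + P t \<bullet> P'') (at t)"
        by (simp add: has_real_derivative_iff_has_vector_derivative add.commute)
      then show ?thesis unfolding q'_def by (rule DERIV_cmult)
    qed
    have D: "D \<ge> 0"
    proof -
      define G where "G = outer x (P t)"
      define g where "g = G \<bullet> v"
      have h0: "h > 0" using hpos[OF t] by (simp add: h_def)
      have g: "g = P t \<bullet> P' t"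
        unfolding g_def G_def inner_outer P'_def v_def by (rule inner_commute)
      \<comment> \<open>the eikonal equation, which makes the gradient terms cancel\<close>
      have GG: "G \<bullet> G = h"
        using x(1) qt by (simp add: G_def norm_outer q_def flip: power2_norm_eq_inner)
      have "\<gamma>'' t = (2 * g / h) *\<^sub>R v - ((norm v)\<^sup>2 / h) *\<^sub>R G"
        using geo[OF t] christoffel_condition_metric[OF GL[OF t] x, of "\<gamma>' t"]
        by (simp add: h_def g_def G_def P_def v_def eq_neg_iff_add_eq_0 algebra_simps)
      then have "G \<bullet> \<gamma>'' t = 2 * g\<^sup>2 / h - (norm v)\<^sup>2"
        using h0 by (simp add: inner_diff_right GG power2_eq_square flip: g_def)
      moreover have "P t \<bullet> P'' = G \<bullet> \<gamma>'' t"
        unfolding G_def inner_outer P''_def by (rule inner_commute)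
      ultimately have PP'': "P t \<bullet> P'' = 2 * g\<^sup>2 / h - (norm v)\<^sup>2" by simp
      have "D = - ((2 * ((norm (P' t))\<^sup>2 + (2 * g\<^sup>2 / h - (norm v)\<^sup>2)) * h - (2 * g) * (2 * g)) / (h * h))"
        by (simp add: D_def q'_def qt PP'' g power2_norm_eq_inner)
      also have "\<dots> = 2 * ((norm v)\<^sup>2 - (norm (P' t))\<^sup>2) / h"
        using h0 by (simp add: field_simps power2_eq_square)
      finally have "D = 2 * ((norm v)\<^sup>2 - (norm (P' t))\<^sup>2) / h" .
      moreover have "norm (P' t) \<le> norm v"
        using norm_adjoint_mult_le[of v x] x(1) by (simp add: P'_def v_def)
      ultimately show ?thesis using h0 by simp
    qed
    have near: "\<forall>\<^sub>F s in nhds t. s \<in> interior J"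
      using ti by (intro eventually_nhds_in_open) auto
    show "\<exists>L L' D. L t = ln (inverse (?h t)) \<and>
        (\<forall>\<^sub>F s in nhds t. L s \<le> ln (inverse (?h s))) \<and>
        (\<forall>\<^sub>F s in nhds t. (L has_real_derivative L' s) (at s)) \<and>
        (L' has_real_derivative D) (at t) \<and> D \<ge> 0"
    proof (intro exI conjI)
      let ?L = "\<lambda>s. - ln (q s)"
      show "?L t = ln (inverse (?h t))" using hpos[OF t] qt by (simp add: h_def ln_inverse)
      show "\<forall>\<^sub>F s in nhds t. ?L s \<le> ln (inverse (?h s))"
        using near
      proof eventually_elim
        case (elim s)
        then have s: "s \<in> J" using interior_subset by blast
        have "ln (?h s) \<le> ln (q s)" using qge[of s] by (simp only: ln_le_cancel_iff hpos[OF s] qpos[OF s])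
        then show ?case using hpos[OF s] by (simp add: ln_inverse)
      qed
      show "\<forall>\<^sub>F s in nhds t. (?L has_real_derivative - (q' s / q s)) (at s)"
        using near
      proof eventually_elim
        case (elim s)
        then have "q s > 0" using interior_subset qpos by blast
        then show ?case
          using dq[OF elim] by (auto intro!: derivative_eq_intros simp: divide_inverse)
      qed
      show "((\<lambda>s. - (q' s / q s)) has_real_derivative D) (at t)"
        unfolding D_def using qpos[OF t] by (intro DERIV_minus DERIV_divide dq' dq ti) simp
      show "D \<ge> 0" by (rule D)
    qed
  qed
qed

theorem theorem1:
  assumes "CARD('n::finite) \<le> CARD('m::finite)"
  shows "log_convex (GL_gt :: (real^'m^'n) set) condition_metric (\<lambda>A. inverse ((sigma_min A)\<^sup>2))
       \<and> log_convex (GL_gt :: (complex^'m^'n) set) condition_metric (\<lambda>A. inverse ((sigma_min A)\<^sup>2))"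
  by (intro conjI log_convex_sigma_min)

end
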